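(* Let $n$ and $k$ be integers with $0 < k < n$, and let $S$ be an ordering of the set of all permutations of $(1,\ldots,n)$ (the common vertex set of the graphs $FJ(n,k)$ and $FJ(n,k-1)$). Let $\overline{S}$ be the concatenation of $\phi_1(S), \phi_2(S), \ldots, \phi_{n+1}(S)$ in that order, a vertex ordering of $FJ(n+1,k)$. Then: 1. For all $i,j \in [n+1]$ with $|i-j| > k$, $A(FJ(n+1,k),\overline{S})[i,j]$ is the $n! \times n!$ zero matrix. 2. $A(FJ(n+1,k),\overline{S})[1,1] = A(FJ(n+1,k),\overline{S})[n+1,n+1] = A(FJ(n,k),S)$. 3. For all $i,j \in [n+1]$ with $|i-j| = 1$, $A(FJ(n+1,k),\overline{S})[i,j] = A(FJ(n,k-1),S)$.
   Context: Write $[m]=\{1,\ldots,m\}$. For a permutation $u=(u_1,\ldots,u_n)$ of $(1,2,\ldots,n)$ and $i \in [n]$ write $u(i) = \{u_1, u_2, \ldots, u_i\}$. For integers $0 \leq k < n$, the Full-Flag Johnson graph $FJ(n,k)$ has as vertex set all permutations of $(1,\ldots,n)$; two vertices $u,v$ (possibly equal) are adjacent if and only if $u(i) \neq v(i)$ for exactly $k$ integers $i \in [n]$. (Thus in $FJ(n,0)$ every vertex is adjacent to itself.) For $i \in [n+1]$, the insertion function $\phi_i$ sends a permutation $u=(u_1,\ldots,u_n)$ of $(1,\ldots,n)$ to the permutation $\phi_i(u) = (u_1,\ldots,u_{i-1},n+1,u_i,\ldots,u_n)$ of $(1,\ldots,n+1)$. If $S$ is a sequence of permutations, $\phi_i(S)$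 is the sequence obtained by applying $\phi_i$ to each term. For a graph $G$ on $m$ vertices with vertex ordering $T=(v_1,\ldots,v_m)$, $A(G,T)$ is the $m\times m$ adjacency matrix whose $(i,j)$ entry is $1$ if $v_i$ and $v_j$ are adjacent in $G$ and $0$ otherwise (a loop gives diagonal entry $1$). The $(n+1)!\times(n+1)!$ matrix $A(FJ(n+1,k),\overline{S})$ is divided into $(n+1)^2$ consecutive blocks of size $n!\times n!$; $A(FJ(n+1,k),\overline{S})[i,j]$ denotes the $(i,j)$th block, whose rows correspond to the vertices of $\phi_i(S)$ and columns to those of $\phi_j(S)$. *)

theory Defs
  imports
    "HOL-Combinatorics.Multiset_Permutations"
    "Graph_Theory.Pair_Digraph"
    "Jordan_Normal_Form.Matrix"
begin

text \<open>
  A permutation \<open>(u\<^sub>1, \<dots>, u\<^sub>n)\<close> is the list of its values, an element of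
  \<open>permutations_of_set {1..n}\<close>; \<open>prefix_set u i\<close> is \<open>u(i) = {u\<^sub>1, \<dots>, u\<^sub>i}\<close>.
\<close>

definition prefix_set :: "nat list \<Rightarrow> nat \<Rightarrow> nat set" where
  "prefix_set u i = set (take i u)"

text \<open>
  The undirected graph \<open>FJ(n,k)\<close>, which has loops for \<open>k = 0\<close>, is a digraph with a symmetric
  arc set. It is meant for \<open>k < n\<close>.
\<close>

definition FJ :: "nat \<Rightarrow> nat \<Rightarrow> nat list pair_pre_digraph" where
  "FJ n k = \<lparr>pverts = permutations_of_set {1..n},
     parcs = {(u, v). u \<in> permutations_of_set {1..n} \<and> v \<in> permutations_of_set {1..n} \<and>
                      card {i \<in> {1..n}. prefix_set u i \<noteq> prefix_set v i} = k}\<rparr>"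

lemma sym_parcs_FJ: "sym (parcs (FJ n k))"
proof -
  have "{i \<in> {1..n}. prefix_set u i \<noteq> prefix_set v i} =
        {i \<in> {1..n}. prefix_set v i \<noteq> prefix_set u i}" for u v
    by auto
  then show ?thesis
    by (simp add: FJ_def sym_def)
qed

text \<open>
  The insertion function \<open>\<phi>\<^sub>i\<close> on permutations of \<open>(1, \<dots>, n)\<close>, for \<open>1 \<le> i \<le> n + 1\<close>: the new
  entry \<open>n + 1\<close> is put at the \<open>i\<close>th position, counted from 1.
\<close>

definition insertion :: "nat \<Rightarrow> nat \<Rightarrow> nat list \<Rightarrow> nat list" where
  "insertion n i u = take (i - 1) u @ [n + 1] @ drop (i - 1) u"

definition insertion_concat :: "nat \<Rightarrow> nat list list \<Rightarrow> nat list list" where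
  "insertion_concat n S = concat (map (\<lambda>i. map (insertion n i) S) [1..<n + 2])"

text \<open>Matrix indices start at 0, like list positions.\<close>

definition adj_mat :: "'a pair_pre_digraph \<Rightarrow> 'a list \<Rightarrow> real mat" where
  "adj_mat G T =
     mat (length T) (length T) (\<lambda>(r, c). if (T ! r, T ! c) \<in> parcs G then 1 else 0)"

text \<open>
  The block in block row \<open>i\<close> and block column \<open>j\<close>, both counted from 1, of a matrix divided
  into consecutive blocks of size \<open>m \<times> m\<close>.
\<close>

definition block :: "nat \<Rightarrow> 'a mat \<Rightarrow> nat \<Rightarrow> nat \<Rightarrow> 'a mat" where
  "block m A i j = mat m m (\<lambda>(r, c). A $$ ((i - 1) * m + r, (j - 1) * m + c))"

lemma insertion_concat_vertex_ordering:
  assumes "distinct S" and S: "set S = permutations_of_set {1..n}"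
  shows "distinct (insertion_concat n S)"
    and "set (insertion_concat n S) = pverts (FJ (n + 1) k)"
    and "length (insertion_concat n S) = (n + 1) * fact n"
proof -
  have len: "length S = fact n"
    using assms distinct_card[of S] by simp
  show lenc: "length (insertion_concat n S) = (n + 1) * fact n"
    by (simp add: insertion_concat_def length_concat comp_def len sum_list_triv)
  have u: "distinct u \<and> set u = {1..n} \<and> length u = n" if "u \<in> set S" for u
    using that S length_finite_permutations_of_set[of u "{1..n}"]
    by (auto simp: permutations_of_set_def)
  have sub: "insertion n i u \<in> permutations_of_set {1..n + 1}" if "u \<in> set S" for i u
  proof -
    have *: "set (take (i - 1) u) \<union> set (drop (i - 1) u) = {1..n}"
      using u[OF that] by (metis append_take_drop_id set_append)
    have d: "set (take (i - 1) u) \<inter> set (drop (i - 1) u) = {}"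
      using u[OF that] by (intro set_take_disj_set_drop_if_distinct) auto
    have nin: "n + 1 \<notin> set (take (i - 1) u) \<union> set (drop (i - 1) u)"
      unfolding * by simp
    show ?thesis
    proof (rule permutations_of_setI)
      show "set (insertion n i u) = {1..n + 1}"
        using * by (auto simp: insertion_def)
      show "distinct (insertion n i u)"
        using d nin u[OF that] by (simp add: insertion_def)
    qed
  qed
  have sup: "w \<in> set (insertion_concat n S)" if w: "w \<in> permutations_of_set {1..n + 1}" for w
  proof -
    have dw: "distinct w" "set w = {1..n + 1}" "length w = n + 1"
      using w length_finite_permutations_of_set[OF w] by (auto simp: permutations_of_set_def)
    then obtain xs ys where xy: "w = xs @ (n + 1) # ys"
      by (metis split_list atLeastAtMost_iff le_add2 order_refl)
    have "set (xs @ ys) = {1..n}"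
    proof -
      have "set (xs @ ys) = set w - {n + 1}"
        using dw(1) xy by auto
      then show ?thesis using dw(2) by auto
    qed
    then have "xs @ ys \<in> set S"
      using dw(1) xy S by (auto intro!: permutations_of_setI)
    moreover have "w = insertion n (length xs + 1) (xs @ ys)"
      by (simp add: insertion_def xy)
    moreover have "length xs + 1 \<in> set [1..<n + 2]"
      using dw(3) unfolding xy set_upt by simp
    ultimately show ?thesis
      unfolding insertion_concat_def by (auto simp del: upt_Suc)
  qed
  have eq: "set (insertion_concat n S) = permutations_of_set {1..n + 1}"
  proof
    show "set (insertion_concat n S) \<subseteq> permutations_of_set {1..n + 1}"
      using sub unfolding insertion_concat_def by (auto simp del: upt_Suc)
  qed (use sup in blast)
  then show "set (insertion_concat n S) = pverts (FJ (n + 1) k)"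
    by (simp add: FJ_def)
  show "distinct (insertion_concat n S)"
    by (rule card_distinct) (simp only: eq lenc, simp)
qed

end

theory Submission
  imports Defs
begin

text \<open>
  If \<open>D\<close> is the set of positions at which the prefix sets of \<open>u\<close> and \<open>v\<close> differ and \<open>i \<le> j\<close>, then
  the prefix sets of \<open>\<phi>\<^sub>i(u)\<close> and \<open>\<phi>\<^sub>j(v)\<close> differ exactly at the \<open>l \<in> D\<close> with \<open>l < i\<close>, at every \<open>l\<close>
  with \<open>i \<le> l < j\<close> (only the first contains \<open>n + 1\<close>), and at the \<open>l + 1\<close> with \<open>l \<in> D\<close>,
  \<open>j - 1 \<le> l\<close>. So there are at least \<open>j - i\<close> such positions, \<open>card D + 1\<close> of them for \<open>j = i + 1\<close>,
  and, as \<open>n \<notin> D\<close>, \<open>card D\<close> of them for \<open>i = j = 1\<close> and for \<open>i = j = n + 1\<close>.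
\<close>

section \<open>Prefix sets before and after insertion\<close>

definition differing_prefixes :: "nat \<Rightarrow> nat list \<Rightarrow> nat list \<Rightarrow> nat set" where
  "differing_prefixes n u v = {i \<in> {1..n}. prefix_set u i \<noteq> prefix_set v i}"

lemma differing_prefixes_commute: "differing_prefixes n u v = differing_prefixes n v u"
  by (auto simp: differing_prefixes_def)

lemma finite_differing_prefixes: "finite (differing_prefixes n u v)"
  by (simp add: differing_prefixes_def)

text \<open>At position \<open>n\<close> both prefix sets are all of \<open>{1..n}\<close>, so no
  difference can occur there; this is what settles the last diagonal block.\<close>

lemma differing_prefixes_less:
  assumes u: "u \<in> permutations_of_set {1..n}" and v: "v \<in> permutations_of_set {1..n}"
    and l: "l \<in> differing_prefixes n u v"
  shows "1 \<le> l" "l < n"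
proof -
  have "length u = n" "length v = n"
    using length_finite_permutations_of_set[OF u] length_finite_permutations_of_set[OF v] by auto
  then have "prefix_set u n = prefix_set v n"
    using u v by (simp add: prefix_set_def permutations_of_set_def)
  then show "1 \<le> l" "l < n"
    using l by (auto simp: differing_prefixes_def order_le_less)
qed

lemma arc_FJ_iff:
  assumes "u \<in> permutations_of_set {1..n}" "v \<in> permutations_of_set {1..n}"
  shows "(u, v) \<in> parcs (FJ n k) \<longleftrightarrow> card (differing_prefixes n u v) = k"
  using assms by (simp add: FJ_def differing_prefixes_def)

text \<open>From position \<open>i\<close> on, the new entry takes up one place, leaving room for
  \<open>l - 1\<close> old ones. There \<open>l \<ge> i \<ge> 1\<close>, so the subtraction is not
  truncated.\<close>

lemma prefix_set_insertion:
  assumes "1 \<le> i" "i \<le> length u + 1"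
  shows "prefix_set (insertion n i u) l =
    (if l < i then prefix_set u l else insert (n + 1) (prefix_set u (l - 1)))"
proof (cases "l < i")
  case True
  then have "l \<le> i - 1"
    by simp
  then show ?thesis
    using True assms by (simp add: prefix_set_def insertion_def min_def)
next
  case False
  \<comment> \<open>With \<open>a = i - 1\<close> entries before the new one, the prefix of length
    \<open>l = a + 1 + m\<close> consists of \<open>take a u\<close>, the new entry and
    \<open>take m (drop a u)\<close>.\<close>
  then obtain m where m: "l = i + m"
    by (metis le_Suc_ex not_less)
  obtain a where a: "i = Suc a"
    using assms by (metis Suc_le_D One_nat_def)
  have "take (a + m) u = take a u @ take m (drop a u)"
    by (rule take_add)
  then show ?thesis
    using assms by (simp add: prefix_set_def insertion_def min_def a m Suc_diff_le)
qed

lemma differing_prefixes_insertion: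
  assumes u: "u \<in> permutations_of_set {1..n}" and v: "v \<in> permutations_of_set {1..n}"
    and ij: "1 \<le> i" "i \<le> j" "j \<le> n + 1"
  shows "differing_prefixes (n + 1) (insertion n i u) (insertion n j v) =
    {l \<in> differing_prefixes n u v. l < i} \<union> {i..<j} \<union>
    Suc ` {l \<in> differing_prefixes n u v. j \<le> l + 1}" (is "?L = ?A \<union> ?B \<union> ?C")
proof (rule Set.set_eqI)
  fix l
  have len: "length u = n" "length v = n"
    using length_finite_permutations_of_set[OF u] length_finite_permutations_of_set[OF v] by auto
  have nin: "n + 1 \<notin> prefix_set u m" "n + 1 \<notin> prefix_set v m" for m
    using u v by (auto simp: prefix_set_def permutations_of_set_def dest: in_set_takeD)
  have L: "l \<in> ?L \<longleftrightarrow> l \<in> {1..n + 1} \<and>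
      prefix_set (insertion n i u) l \<noteq> prefix_set (insertion n j v) l"
    by (simp add: differing_prefixes_def)
  note pu = prefix_set_insertion[of i u n l] and pv = prefix_set_insertion[of j v n l]
  consider "l < i" | "i \<le> l" "l < j" | "j \<le> l"
    by linarith
  then show "l \<in> ?L \<longleftrightarrow> l \<in> ?A \<union> ?B \<union> ?C"
  proof cases
    case 1
    then show ?thesis
      using ij len pu pv unfolding L by (auto simp: differing_prefixes_def)
  next
    case 2
    then have "n + 1 \<in> prefix_set (insertion n i u) l"
      "n + 1 \<notin> prefix_set (insertion n j v) l"
      using ij len pu pv nin by simp_all
    then have "prefix_set (insertion n i u) l \<noteq> prefix_set (insertion n j v) l"
      by blast
    then show ?thesis
      using 2 ij unfolding L by auto
  next
    case 3
    then obtain m where m: "l = Suc m"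
      using ij by (cases l) auto
    \<comment> \<open>Both sides arise by inserting \<open>n + 1\<close> into sets that lack it, so
      it can be cancelled.\<close>
    have "prefix_set (insertion n i u) l \<noteq> prefix_set (insertion n j v) l \<longleftrightarrow>
        prefix_set u m \<noteq> prefix_set v m"
      using ij len pu pv nin 3 m insert_ident[of "n + 1" "prefix_set u m" "prefix_set v m"] by simp
    \<comment> \<open>For \<open>j = l = 1\<close> the old position is 0, outside
      \<open>{1..n}\<close>; the empty prefixes agree there, so no extra difference arises.\<close>
    moreover have "prefix_set u 0 = prefix_set v 0"
      by (simp add: prefix_set_def)
    ultimately have "l \<in> ?L \<longleftrightarrow> m \<in> differing_prefixes n u v"
      unfolding L using m by (cases m) (auto simp: differing_prefixes_def)
    then show ?thesis
      using 3 m ij by auto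
  qed
qed

section \<open>Counting the differing positions\<close>

lemma card_differing_prefixes_insertion:
  assumes "u \<in> permutations_of_set {1..n}" "v \<in> permutations_of_set {1..n}"
    and "1 \<le> i" "i \<le> j" "j \<le> n + 1"
  shows "card (differing_prefixes (n + 1) (insertion n i u) (insertion n j v)) =
    card {l \<in> differing_prefixes n u v. l < i} + (j - i) +
    card {l \<in> differing_prefixes n u v. j \<le> l + 1}"
proof -
  have "card (Suc ` {l \<in> differing_prefixes n u v. j \<le> l + 1}) =
      card {l \<in> differing_prefixes n u v. j \<le> l + 1}"
    by (rule card_image) simp
  \<comment> \<open>The three pieces lie below \<open>i\<close>, in \<open>{i..<j}\<close>, and from
    \<open>j\<close> on.\<close>
  moreover have "{l \<in> differing_prefixes n u v. l < i} \<inter> {i..<j} = {}"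
    "({l \<in> differing_prefixes n u v. l < i} \<union> {i..<j}) \<inter>
      Suc ` {l \<in> differing_prefixes n u v. j \<le> l + 1} = {}"
    using assms(4) by auto
  ultimately show ?thesis
    unfolding differing_prefixes_insertion[OF assms]
    by (simp add: card_Un_disjoint finite_differing_prefixes)
qed

text \<open>The middle piece \<open>{i..<j}\<close> alone gives the bound; for \<open>j < i\<close>
  the roles of \<open>u\<close> and \<open>v\<close> are exchanged.\<close>

lemma card_differing_prefixes_insertion_ge:
  assumes u: "u \<in> permutations_of_set {1..n}" and v: "v \<in> permutations_of_set {1..n}"
    and i: "i \<in> {1..n + 1}" and j: "j \<in> {1..n + 1}"
  shows "\<bar>int i - int j\<bar> \<le>
    int (card (differing_prefixes (n + 1) (insertion n i u) (insertion n j v)))"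
proof (cases "i \<le> j")
  case True
  then show ?thesis
    using card_differing_prefixes_insertion[OF u v, of i j] i j by simp
next
  case False
  then show ?thesis
    using card_differing_prefixes_insertion[OF v u, of j i] i j
    by (simp add: differing_prefixes_commute)
qed

text \<open>For \<open>j = Suc i\<close> the conditions \<open>l < i\<close> and
  \<open>j \<le> l + 1\<close> are complementary, so the outer pieces together count each old
  difference once, and the middle piece is \<open>{i}\<close>.\<close>

lemma card_differing_prefixes_insertion_Suc:
  assumes "u \<in> permutations_of_set {1..n}" "v \<in> permutations_of_set {1..n}"
    and "1 \<le> i" "i \<le> n"
  shows "card (differing_prefixes (n + 1) (insertion n i u) (insertion n (Suc i) v)) =
    Suc (card (differing_prefixes n u v))"
proof -
  let ?D = "differing_prefixes n u v"
  have "card {l \<in> ?D. l < i} + card {l \<in> ?D. i \<le> l} = card ({l \<in> ?D. l < i} \<union> {l \<in> ?D. i \<le> l})"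
    by (rule card_Un_disjoint[symmetric]) (auto simp: finite_differing_prefixes)
  also have "{l \<in> ?D. l < i} \<union> {l \<in> ?D. i \<le> l} = ?D"
    by auto
  finally show ?thesis
    using card_differing_prefixes_insertion[OF assms(1-3), of "Suc i"] assms(4) by simp
qed

lemma card_differing_prefixes_insertion_adjacent:
  assumes u: "u \<in> permutations_of_set {1..n}" and v: "v \<in> permutations_of_set {1..n}"
    and i: "i \<in> {1..n + 1}" and j: "j \<in> {1..n + 1}" and ij: "\<bar>int i - int j\<bar> = 1"
  shows "card (differing_prefixes (n + 1) (insertion n i u) (insertion n j v)) =
    Suc (card (differing_prefixes n u v))"
proof -
  consider "j = Suc i" | "i = Suc j"
    using ij by linarith
  then show ?thesis
  proof cases
    case 1
    then show ?thesis
      using card_differing_prefixes_insertion_Suc[OF u v, of i] i j by simp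
  next
    case 2
    then show ?thesis
      using card_differing_prefixes_insertion_Suc[OF v u, of j] i j
      by (simp add: differing_prefixes_commute)
  qed
qed

lemma card_differing_prefixes_insertion_extremal:
  assumes u: "u \<in> permutations_of_set {1..n}" and v: "v \<in> permutations_of_set {1..n}"
    and i: "i = 1 \<or> i = n + 1"
  shows "card (differing_prefixes (n + 1) (insertion n i u) (insertion n i v)) =
    card (differing_prefixes n u v)"
proof -
  let ?D = "differing_prefixes n u v"
  \<comment> \<open>For \<open>i = 1\<close> the bound \<open>1 \<le> l\<close> empties the first
    piece; for \<open>i = n + 1\<close> the bound \<open>l < n\<close> empties the last. The other
    outer piece is then all of \<open>?D\<close>.\<close>
  have "{l \<in> ?D. l < 1} = {}" "{l \<in> ?D. 1 \<le> l + 1} = ?D"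
    "{l \<in> ?D. l < n + 1} = ?D" "{l \<in> ?D. n + 1 \<le> l + 1} = {}"
    using differing_prefixes_less[OF u v] by fastforce+
  then show ?thesis
    using i card_differing_prefixes_insertion[OF u v, of i i] by (auto simp: card_eq_0_iff)
qed

section \<open>Entries of the blocks\<close>

lemma nth_concat_uniform:
  assumes "\<And>xs. xs \<in> set xss \<Longrightarrow> length xs = m" "a < length xss" "r < m"
  shows "concat xss ! (a * m + r) = xss ! a ! r"
  using assms
proof (induction xss arbitrary: a)
  case (Cons xs xss)
  then show ?case
    by (cases a) (auto simp: nth_append add.assoc)
qed simp

lemma nth_insertion_concat:
  assumes "i \<in> {1..n + 1}" "r < length S"
  shows "insertion_concat n S ! ((i - 1) * length S + r) = insertion n i (S ! r)"
proof -
  have "insertion_concat n S ! ((i - 1) * length S + r) =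
      map (\<lambda>i. map (insertion n i) S) [1..<n + 2] ! (i - 1) ! r"
    unfolding insertion_concat_def using assms by (intro nth_concat_uniform) auto
  also have "\<dots> = insertion n i (S ! r)"
    using assms by (cases i) (simp_all del: upt_Suc)
  finally show ?thesis .
qed

text \<open>Reduces claims about blocks to counting: row \<open>r\<close> of block row
  \<open>i\<close> belongs to the vertex \<open>insertion n i (S ! r)\<close>.\<close>

lemma block_adj_mat_insertion_concat:
  assumes S: "distinct S" "set S = permutations_of_set {1..n}"
    and i: "i \<in> {1..n + 1}" and j: "j \<in> {1..n + 1}"
  shows "block (fact n) (adj_mat (FJ (n + 1) k) (insertion_concat n S)) i j =
    mat (fact n) (fact n) (\<lambda>(r, c).
      if card (differing_prefixes (n + 1) (insertion n i (S ! r)) (insertion n j (S ! c))) = k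
      then 1 else 0)"
proof -
  have len: "length S = fact n"
    using S distinct_card[of S] by simp
  note ic = insertion_concat_vertex_ordering[OF S]
  \<comment> \<open>Every index used by a block stays inside the large matrix, where
    \<open>mat\<close> is given by its entry function.\<close>
  have idx: "(a - 1) * fact n + r < length (insertion_concat n S)"
    if "a \<in> {1..n + 1}" "r < fact n" for a r
  proof -
    have "(a - 1) * fact n + r < (a - 1) * fact n + fact n"
      using that by simp
    also have "\<dots> = a * fact n"
      using that by (cases a) auto
    also have "\<dots> \<le> (n + 1) * fact n"
      using that by (intro mult_right_mono) auto
    finally show ?thesis
      by (simp add: ic(3))
  qed
  have nth: "insertion_concat n S ! ((a - 1) * fact n + r) = insertion n a (S ! r)"
    if "a \<in> {1..n + 1}" "r < fact n" for a r
    using nth_insertion_concat[of a n r S] that by (simp add: len)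
  have perm: "insertion n a (S ! r) \<in> permutations_of_set {1..n + 1}"
    if "a \<in> {1..n + 1}" "r < fact n" for a r
    using nth_mem[OF idx[OF that]] nth[OF that] ic(2)[of k] by (simp add: FJ_def)
  show ?thesis
    unfolding block_def adj_mat_def
    by (rule eq_matI) (use i j in \<open>simp_all add: idx nth arc_FJ_iff[OF perm perm] del: One_nat_def\<close>)
qed

lemma adj_mat_FJ:
  assumes "distinct S" "set S = permutations_of_set {1..n}"
  shows "adj_mat (FJ n k) S = mat (fact n) (fact n) (\<lambda>(r, c).
    if card (differing_prefixes n (S ! r) (S ! c)) = k then 1 else 0)"
proof -
  have len: "length S = fact n"
    using assms distinct_card[of S] by simp
  then have "S ! r \<in> permutations_of_set {1..n}" if "r < fact n" for r
    using that assms(2) nth_mem by metis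
  then show ?thesis
    unfolding adj_mat_def by (intro eq_matI) (simp_all add: len arc_FJ_iff)
qed

theorem theorem5p2:
  fixes n k :: nat and S :: "nat list list"
  assumes "0 < k" and "k < n"
    and "distinct S" and "set S = permutations_of_set {1..n}"
  shows "(\<forall>i\<in>{1..n + 1}. \<forall>j\<in>{1..n + 1}. \<bar>int i - int j\<bar> > int k \<longrightarrow>
            block (fact n) (adj_mat (FJ (n + 1) k) (insertion_concat n S)) i j
              = 0\<^sub>m (fact n) (fact n)) \<and>
         (block (fact n) (adj_mat (FJ (n + 1) k) (insertion_concat n S)) 1 1
              = adj_mat (FJ n k) S \<and>
          block (fact n) (adj_mat (FJ (n + 1) k) (insertion_concat n S)) (n + 1) (n + 1)
              = adj_mat (FJ n k) S) \<and>
         (\<forall>i\<in>{1..n + 1}. \<forall>j\<in>{1..n + 1}. \<bar>int i - int j\<bar> = 1 \<longrightarrow>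
            block (fact n) (adj_mat (FJ (n + 1) k) (insertion_concat n S)) i j
              = adj_mat (FJ n (k - 1)) S)"
proof -
  note block = block_adj_mat_insertion_concat[OF assms(3,4), where k = k]
    and adj = adj_mat_FJ[OF assms(3,4)]
  have "length S = fact n"
    using assms distinct_card[of S] by simp
  then have perm: "S ! r \<in> permutations_of_set {1..n}" if "r < fact n" for r
    using that assms(4) nth_mem by metis
  \<comment> \<open>Every count is at least the distance of \<open>i\<close> and \<open>j\<close>,
    hence above \<open>k\<close>, so no entry is 1.\<close>
  have far: "block (fact n) (adj_mat (FJ (n + 1) k) (insertion_concat n S)) i j
      = 0\<^sub>m (fact n) (fact n)"
    if ij: "i \<in> {1..n + 1}" "j \<in> {1..n + 1}" "\<bar>int i - int j\<bar> > int k" for i j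
    unfolding block[OF ij(1,2)]
  proof (rule eq_matI)
    fix r c
    assume "r < dim_row (0\<^sub>m (fact n) (fact n) :: real mat)"
      "c < dim_col (0\<^sub>m (fact n) (fact n) :: real mat)"
    then show "mat (fact n) (fact n) (\<lambda>(r, c).
        if card (differing_prefixes (n + 1) (insertion n i (S ! r)) (insertion n j (S ! c))) = k
        then 1 else 0) $$ (r, c) = 0\<^sub>m (fact n) (fact n) $$ (r, c)"
      using card_differing_prefixes_insertion_ge[OF perm perm ij(1,2), of r c] ij(3) by auto
  qed simp_all
  have extremal: "block (fact n) (adj_mat (FJ (n + 1) k) (insertion_concat n S)) i i
      = adj_mat (FJ n k) S" if i: "i = 1 \<or> i = n + 1" for i
  proof -
    have "i \<in> {1..n + 1}"
      using i by auto
    note block = block[OF this this]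
    show ?thesis
      unfolding adj block
      by (intro eq_matI)
        (simp_all add: card_differing_prefixes_insertion_extremal[OF perm perm i, simplified])
  qed
  have adjacent: "block (fact n) (adj_mat (FJ (n + 1) k) (insertion_concat n S)) i j
      = adj_mat (FJ n (k - 1)) S"
    if ij: "i \<in> {1..n + 1}" "j \<in> {1..n + 1}" "\<bar>int i - int j\<bar> = 1" for i j
  proof -
    \<comment> \<open>The one additional differing position turns \<open>k\<close> into
      \<open>k - 1\<close>, which is not truncated since \<open>0 < k\<close>.\<close>
    have "Suc m = k \<longleftrightarrow> m = k - 1" for m
      using assms(1) by auto
    then show ?thesis
      unfolding block[OF ij(1,2)] adj
      by (intro eq_matI)
        (simp_all add: card_differing_prefixes_insertion_adjacent[OF perm perm ij, simplified])
  qed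
  show ?thesis
    using far extremal adjacent by blast
qed

end
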